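(* Let $V$ be the vertex set of a finite graph, or of a countably infinite graph with bounded degree. Let $W$ be a finite subset of $V$. Then for $0\le t<1$, for blocking RSA, $$\frac{d}{dt}P[X_t^V(v)=0,\ v\in W]=-\sum_{v\in W}P\big[X_t^{V\setminus\{v\}}(w)=0,\ w\in (W\cup\mathcal N_1(v,V))\setminus\{v\}\big].$$
   Context: Graphs have no loops or multiple edges; a subset of $V$ carries the induced subgraph structure. $\mathcal N_1(v,V)$ is the set of $w\in V$ at graph distance at most $1$ from $v$ in $V$. $P[X(v)=0,\ v\in A]$ is the probability that $X(v)=0$ for every $v\in A$. At $t=0$ the derivative is a right derivative. Blocking RSA on a finite graph $V$: $\tau_v$, $v\in V$, are i.i.d. uniform on $(0,1)$. All sites are initially vacant (state $0$); at time $\tau_v$ site $v$ becomes occupied (state $1$) if and only if none of its neighbours is already occupied; otherwise nothing changes at that time. Occupied sites stay occupied forever. $X_t^V(v)\in\{0,1\}$ is the state of $v$ at time $t$. For countably infinite $V$ of bounded degree, $X_t^V(v):=\lim_n X_t^{V_n}(v)$, where $(V_n)$ is any sequence of finite subsets of $V$ with $\bigcup_n\bigcap_{m\ge n}V_m=V$ and the process on the induced subgraph $V_n$ uses the same $(\tau_v)$; almost surely this limit exists for all $v,t$ and does not depend on the sequence. *)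

theory Defs
  imports "HOL-Probability.Probability" "HOL-Library.Extended_Nat"
begin

definition simple_graph :: "'a set \<Rightarrow> 'a rel \<Rightarrow> bool" where
  "simple_graph V E \<longleftrightarrow> E \<subseteq> V \<times> V \<and> sym E \<and> irrefl E"

definition bounded_degree :: "'a set \<Rightarrow> 'a rel \<Rightarrow> bool" where
  "bounded_degree V E \<longleftrightarrow> (\<exists>d. \<forall>v\<in>V. finite (E `` {v}) \<and> card (E `` {v}) \<le> d)"

text \<open>
  Below, \<^term>\<open>E\<close> may be the edge set of a larger graph: all notions refer to the subgraph
  induced on the vertex set \<^term>\<open>V\<close>.
\<close>

definition graph_dist :: "'a set \<Rightarrow> 'a rel \<Rightarrow> 'a \<Rightarrow> 'a \<Rightarrow> enat" where
  "graph_dist V E v w = (INF n \<in> {n. (v, w) \<in> (E \<inter> V \<times> V) ^^ n}. enat n)"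

definition nbhd :: "nat \<Rightarrow> 'a set \<Rightarrow> 'a rel \<Rightarrow> 'a \<Rightarrow> 'a set" where
  "nbhd r V E v = {w \<in> V. graph_dist V E v w \<le> enat r}"

text \<open>
  \<^term>\<open>rsa_occupied V E \<tau> t v\<close>: on the finite graph induced on \<^term>\<open>V\<close>, site \<^term>\<open>v\<close> is
  occupied at time \<^term>\<open>t\<close>. Its arrival time has passed, and at that time \<^term>\<open>\<tau> v\<close> no
  neighbour that arrived strictly earlier was occupied. A site outside \<^term>\<open>V\<close> is never
  occupied; the guard \<^term>\<open>finite V\<close> serves termination.
\<close>

context
  notes conj_cong [fundef_cong]
begin

function rsa_occupied :: "'a set \<Rightarrow> 'a rel \<Rightarrow> ('a \<Rightarrow> real) \<Rightarrow> real \<Rightarrow> 'a \<Rightarrow> bool" where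
  "rsa_occupied V E \<tau> t v \<longleftrightarrow>
     finite V \<and> v \<in> V \<and> \<tau> v \<le> t \<and>
     (\<forall>w\<in>V. (v, w) \<in> E \<and> \<tau> w < \<tau> v \<longrightarrow> \<not> rsa_occupied V E \<tau> (\<tau> v) w)"
  by pat_completeness auto
termination
proof (relation "Wellfounded.measure (\<lambda>(V, E, \<tau>, t, v). card {w\<in>V. \<tau> w < \<tau> v})", goal_cases)
  case 1
  show ?case by simp
next
  case (2 V E \<tau> t v w)
  then have "{u\<in>V. \<tau> u < \<tau> w} \<subset> {u\<in>V. \<tau> u < \<tau> v}" by auto
  with 2 show ?case by (simp add: psubset_card_mono)
qed

end

declare rsa_occupied.simps [simp del]

definition exhausts :: "(nat \<Rightarrow> 'a set) \<Rightarrow> 'a set \<Rightarrow> bool" where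
  "exhausts A V \<longleftrightarrow> (\<forall>n. finite (A n) \<and> A n \<subseteq> V) \<and> (\<Union>n. \<Inter>m\<in>{n..}. A m) = V"

text \<open>
  For infinite \<^term>\<open>V\<close> the state is the common limit along all exhausting sequences; it is left
  unspecified for those \<^term>\<open>\<tau>\<close> for which there is no such common limit.
\<close>

definition rsa_state :: "'a set \<Rightarrow> 'a rel \<Rightarrow> ('a \<Rightarrow> real) \<Rightarrow> real \<Rightarrow> 'a \<Rightarrow> nat" where
  "rsa_state V E \<tau> t v =
     (if finite V then of_bool (rsa_occupied V E \<tau> t v)
      else (THE x. \<forall>A. exhausts A V \<longrightarrow>
              (\<lambda>n. of_bool (rsa_occupied (A n) E \<tau> t v)) \<longlonglongrightarrow> x))"

end

theory Submission imports Defs begin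

text \<open>
  Let \<open>p(t)\<close> be the probability that \<open>W\<close> is vacant at time \<open>t\<close>. During a short interval
  \<open>(s, t]\<close>, at most one site in or next to \<open>W\<close> arrives, up to an event of probability
  \<open>O((t - s)\<^sup>2)\<close>. If exactly one such site \<open>v\<close> arrives, then \<open>W\<close> ceases to be vacant if and only if
  \<open>v \<in> W\<close> and both \<open>W\<close> and the neighbours of \<open>v\<close> are vacant at time \<open>s\<close>. Until its arrival, \<open>v\<close> is vacant
  and blocks nobody, so at time \<open>s\<close> the other sites are in the same state as in the process
  on \<open>V - {v}\<close> (\<open>rsa_state_delete_unarrived\<close>, \<open>first_occupation_iff\<close>). That process is independent of
  the clock of \<open>v\<close>, which rings in \<open>(s, t]\<close> with probability \<open>t - s\<close> (\<open>prob_arrives_vacant\<close>). Hence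
  \<open>p(s) - p(t) = (t - s) q(s) + O((t - s)\<^sup>2)\<close>, uniformly in \<open>s \<le> t\<close>, where \<open>q\<close> is the
  sum in the theorem (\<open>prob_vacant_increment\<close>). As \<open>q\<close> is Lipschitz, \<open>q(s)\<close> may be
  replaced by \<open>q(t)\<close>, and \<open>- q\<close> is the derivative of \<open>p\<close>, from the left as well as from the right.

  On an infinite graph, the argument needs the blocking rule for the limiting states
  (\<open>rsa_state_occupied_iff\<close>). The fate of a site is determined by those of its neighbours with earlier
  arrivals. If there is no infinite chain of neighbours with decreasing arrival times, then
  well-founded induction shows that the fate of each site is the same in all large finite
  subgraphs. Almost surely there is no such chain (\<open>AE_well_founded_arrivals\<close>): it would end up in one
  of finitely many time intervals of length \<open>\<delta>\<close>, but with degrees at most \<open>d\<close> at most \<open>d ^ n\<close> walks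
  of length \<open>n\<close> leave a given site, and each has all its arrivals in the interval with probability
  \<open>\<delta> ^ (n + 1)\<close> if its sites are distinct, as they are on a descending chain. For \<open>d \<delta> < 1\<close> this tends
  to \<open>0\<close>.
\<close>

section \<open>The state as a limit along the finite subsets\<close>

lemma rsa_occupied_iff_arrived:
  "rsa_occupied G E \<tau> t v \<longleftrightarrow> \<tau> v \<le> t \<and> rsa_occupied G E \<tau> (\<tau> v) v"
  by (subst (1 2) rsa_occupied.simps) auto

lemma rsa_occupied_at_arrival:
  "rsa_occupied G E \<tau> (\<tau> v) v \<longleftrightarrow>
     finite G \<and> v \<in> G \<and> (\<forall>w\<in>G. (v, w) \<in> E \<and> \<tau> w < \<tau> v \<longrightarrow> \<not> rsa_occupied G E \<tau> (\<tau> w) w)"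
proof -
  have "rsa_occupied G E \<tau> (\<tau> v) v \<longleftrightarrow>
     finite G \<and> v \<in> G \<and> (\<forall>w\<in>G. (v, w) \<in> E \<and> \<tau> w < \<tau> v \<longrightarrow> \<not> rsa_occupied G E \<tau> (\<tau> v) w)"
    by (subst rsa_occupied.simps) simp
  also have "\<dots> \<longleftrightarrow>
     finite G \<and> v \<in> G \<and> (\<forall>w\<in>G. (v, w) \<in> E \<and> \<tau> w < \<tau> v \<longrightarrow> \<not> rsa_occupied G E \<tau> (\<tau> w) w)"
    using rsa_occupied_iff_arrived[of G E \<tau> "\<tau> v"] by (metis order_less_imp_le)
  finally show ?thesis .
qed

text \<open>
  One of the two implications needs an exhausting sequence that avoids the limit: if no finite
  set forces the value \<open>x\<close>, then each initial segment of an enumeration of \<open>V\<close> has a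
  finite superset with a different value, and these supersets exhaust \<open>V\<close>.
\<close>

lemma exhausting_limit_iff_eventually:
  fixes g :: "'a set \<Rightarrow> nat"
  assumes "countable V"
  shows "(\<forall>A. exhausts A V \<longrightarrow> (\<lambda>n. g (A n)) \<longlonglongrightarrow> x) \<longleftrightarrow>
         eventually (\<lambda>G. g G = x) (finite_subsets_at_top V)"
proof
  assume ev: "eventually (\<lambda>G. g G = x) (finite_subsets_at_top V)"
  show "\<forall>A. exhausts A V \<longrightarrow> (\<lambda>n. g (A n)) \<longlonglongrightarrow> x"
  proof (intro allI impI)
    fix A :: "nat \<Rightarrow> 'a set"
    assume A: "exhausts A V"
    obtain F where F: "finite F" "F \<subseteq> V" "\<And>G. finite G \<Longrightarrow> F \<subseteq> G \<Longrightarrow> G \<subseteq> V \<Longrightarrow> g G = x"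
      using ev by (auto simp: eventually_finite_subsets_at_top)
    have "eventually (\<lambda>n. v \<in> A n) sequentially" if "v \<in> F" for v
      using that F(2) A by (force simp: exhausts_def eventually_sequentially)
    then have "eventually (\<lambda>n. \<forall>v\<in>F. v \<in> A n) sequentially"
      using F(1) by (simp add: eventually_ball_finite)
    then have "eventually (\<lambda>n. g (A n) = x) sequentially"
      by eventually_elim (use A F(3) in \<open>auto simp: exhausts_def subset_iff\<close>)
    then show "(\<lambda>n. g (A n)) \<longlonglongrightarrow> x"
      by (simp add: tendsto_discrete)
  qed
next
  assume lim: "\<forall>A. exhausts A V \<longrightarrow> (\<lambda>n. g (A n)) \<longlonglongrightarrow> x"
  show "eventually (\<lambda>G. g G = x) (finite_subsets_at_top V)"
  proof (rule ccontr)
    assume "\<not> ?thesis"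
    then have ex: "\<exists>G. finite G \<and> F \<subseteq> G \<and> G \<subseteq> V \<and> g G \<noteq> x" if "finite F" "F \<subseteq> V" for F
      using that by (auto simp: eventually_finite_subsets_at_top)
    define F where "F n = {v \<in> V. to_nat_on V v \<le> n}" for n
    have "finite (F n)" for n
    proof (rule finite_imageD[of "to_nat_on V"])
      show "finite (to_nat_on V ` F n)"
        by (rule finite_subset[of _ "{..n}"]) (auto simp: F_def)
      show "inj_on (to_nat_on V) (F n)"
        by (rule inj_on_subset[OF inj_on_to_nat_on[OF assms]]) (auto simp: F_def)
    qed
    then have "\<forall>n. \<exists>G. finite G \<and> F n \<subseteq> G \<and> G \<subseteq> V \<and> g G \<noteq> x"
      using ex by (simp add: F_def)
    then obtain A where A: "\<And>n. finite (A n) \<and> F n \<subseteq> A n \<and> A n \<subseteq> V \<and> g (A n) \<noteq> x"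
      by metis
    have "v \<in> (\<Union>n. \<Inter>m\<in>{n..}. A m)" if "v \<in> V" for v
    proof -
      have "v \<in> A m" if "m \<ge> to_nat_on V v" for m
        using A[of m] that \<open>v \<in> V\<close> by (auto simp: F_def)
      then show ?thesis by blast
    qed
    then have "exhausts A V"
      using A unfolding exhausts_def by fastforce
    with lim have "eventually (\<lambda>n. g (A n) = x) sequentially"
      by (simp add: tendsto_discrete)
    then show False
      using A by (simp add: eventually_sequentially)
  qed
qed

lemma rsa_state_eq_THE_eventually:
  assumes "countable V"
  shows "rsa_state V E \<tau> t v =
    (THE x. eventually (\<lambda>G. of_bool (rsa_occupied G E \<tau> t v) = x) (finite_subsets_at_top V))"
proof (cases "finite V")
  case True
  have "eventually P (finite_subsets_at_top V) \<longleftrightarrow> P V" for P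
    using True unfolding eventually_finite_subsets_at_top
    by (metis order_refl subset_antisym)
  then show ?thesis
    using True by (simp add: rsa_state_def)
next
  case False
  then show ?thesis
    using exhausting_limit_iff_eventually[OF assms, of "\<lambda>G. of_bool (rsa_occupied G E \<tau> t v)"]
    by (simp add: rsa_state_def)
qed

lemma rsa_state_eqI:
  assumes "countable V"
    and "eventually (\<lambda>G. rsa_occupied G E \<tau> t v \<longleftrightarrow> b) (finite_subsets_at_top V)"
  shows "rsa_state V E \<tau> t v = of_bool b"
  unfolding rsa_state_eq_THE_eventually[OF assms(1)]
proof (rule the_equality)
  show *: "eventually (\<lambda>G. of_bool (rsa_occupied G E \<tau> t v) = (of_bool b :: nat))
      (finite_subsets_at_top V)"
    using assms(2) by eventually_elim simp
  fix x :: nat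
  assume "eventually (\<lambda>G. of_bool (rsa_occupied G E \<tau> t v) = x) (finite_subsets_at_top V)"
  with * have "eventually (\<lambda>G. x = of_bool b) (finite_subsets_at_top V)"
    by eventually_elim simp
  then show "x = of_bool b"
    by (simp add: eventually_const)
qed

lemma rsa_occupied_cong:
  assumes "\<And>w. w \<in> G \<Longrightarrow> \<tau> w = \<tau>' w"
  shows "rsa_occupied G E \<tau> t v \<longleftrightarrow> rsa_occupied G E \<tau>' t v"
  using assms
proof (induction G E \<tau> t v rule: rsa_occupied.induct)
  case (1 G E \<tau> t v)
  have "rsa_occupied G E \<tau> (\<tau> v) w \<longleftrightarrow> rsa_occupied G E \<tau>' (\<tau> v) w"
    if "finite G" "v \<in> G" "\<tau> v \<le> t" "w \<in> G" "(v, w) \<in> E" "\<tau> w < \<tau> v" for w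
    using "1.IH"[of w] "1.prems" that by blast
  then show ?case
    using "1.prems" by (subst (1 2) rsa_occupied.simps) (metis (no_types, lifting))
qed

lemma rsa_state_cong:
  assumes "countable V" and "\<And>w. w \<in> V \<Longrightarrow> \<tau> w = \<tau>' w"
  shows "rsa_state V E \<tau> t v = rsa_state V E \<tau>' t v"
proof -
  have "rsa_occupied G E \<tau> t v \<longleftrightarrow> rsa_occupied G E \<tau>' t v" if "G \<subseteq> V" for G
    using assms(2) that by (intro rsa_occupied_cong) auto
  then have "eventually (\<lambda>G. of_bool (rsa_occupied G E \<tau> t v) = x) (finite_subsets_at_top V) \<longleftrightarrow>
      eventually (\<lambda>G. of_bool (rsa_occupied G E \<tau>' t v) = x) (finite_subsets_at_top V)" for x :: nat
    by (intro eventually_cong eventually_finite_subsets_at_top_weakI) simp_all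
  then show ?thesis
    by (simp add: rsa_state_eq_THE_eventually[OF assms(1)])
qed


section \<open>Measurability\<close>

text \<open>
  The recursion defining \<^const>\<open>rsa_occupied\<close> follows the random order of the arrivals, which
  gives no fixed induction to prove measurability along. Unfolding it to depth \<open>n\<close>, with a default
  value at the bottom, does; no chain of decreasing arrival times in \<open>G\<close> is longer than \<open>card G\<close>.
\<close>

primrec occupied_to_depth :: "nat \<Rightarrow> 'a set \<Rightarrow> 'a rel \<Rightarrow> ('a \<Rightarrow> real) \<Rightarrow> 'a \<Rightarrow> bool" where
  "occupied_to_depth 0 G E \<tau> v = False"
| "occupied_to_depth (Suc n) G E \<tau> v \<longleftrightarrow>
     (\<forall>w\<in>G. (v, w) \<in> E \<and> \<tau> w < \<tau> v \<longrightarrow> \<not> occupied_to_depth n G E \<tau> w)"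

lemma occupied_to_depth_eq:
  assumes "finite G" "v \<in> G" "card {u \<in> G. \<tau> u < \<tau> v} < n"
  shows "occupied_to_depth n G E \<tau> v \<longleftrightarrow> rsa_occupied G E \<tau> (\<tau> v) v"
  using assms
proof (induction n arbitrary: v)
  case (Suc n)
  have "occupied_to_depth n G E \<tau> w \<longleftrightarrow> rsa_occupied G E \<tau> (\<tau> w) w"
    if "w \<in> G" "\<tau> w < \<tau> v" for w
  proof (rule Suc.IH)
    have "{u \<in> G. \<tau> u < \<tau> w} \<subset> {u \<in> G. \<tau> u < \<tau> v}"
      using that by auto
    then show "card {u \<in> G. \<tau> u < \<tau> w} < n"
      using Suc.prems psubset_card_mono[of "{u \<in> G. \<tau> u < \<tau> v}" "{u \<in> G. \<tau> u < \<tau> w}"] by simp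
  qed (use Suc.prems that in auto)
  then show ?case
    using Suc.prems by (subst rsa_occupied_at_arrival) auto
qed simp

lemma measurable_occupied_to_depth:
  assumes "finite G" "\<And>w. w \<in> G \<Longrightarrow> X w \<in> borel_measurable N" "v \<in> G"
  shows "Measurable.pred N (\<lambda>\<omega>. occupied_to_depth n G E (\<lambda>u. X u \<omega>) v)"
  using assms(3)
proof (induction n arbitrary: v)
  case (Suc n)
  note [measurable] = assms(2) Suc.IH
  have "Measurable.pred N (\<lambda>\<omega>. (v, w) \<in> E \<and> X w \<omega> < X v \<omega> \<longrightarrow>
      \<not> occupied_to_depth n G E (\<lambda>u. X u \<omega>) w)" if [measurable]: "w \<in> G" for w
    using \<open>v \<in> G\<close> by measurable
  then show ?case
    using assms(1) by (simp add: pred_intros_finite(3))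
qed simp

lemma measurable_rsa_occupied:
  assumes "finite G" "\<And>w. w \<in> G \<Longrightarrow> X w \<in> borel_measurable N"
  shows "Measurable.pred N (\<lambda>\<omega>. rsa_occupied G E (\<lambda>u. X u \<omega>) t v)"
proof (cases "v \<in> G")
  case True
  have "rsa_occupied G E (\<lambda>u. X u \<omega>) t v \<longleftrightarrow>
      X v \<omega> \<le> t \<and> occupied_to_depth (Suc (card G)) G E (\<lambda>u. X u \<omega>) v" for \<omega>
    using occupied_to_depth_eq[OF assms(1) True, of "\<lambda>u. X u \<omega>" "Suc (card G)" E]
      card_mono[OF assms(1), of "{u \<in> G. X u \<omega> < X v \<omega>}"]
      rsa_occupied_iff_arrived[of G E "\<lambda>u. X u \<omega>" t v]
    by auto
  moreover note [measurable] = assms(2)[OF True]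
    measurable_occupied_to_depth[OF assms True, where n = "Suc (card G)" and E = E]
  ultimately show ?thesis
    by (simp del: occupied_to_depth.simps)
next
  case False
  then have "\<not> rsa_occupied G E (\<lambda>u. X u \<omega>) t v" for \<omega>
    by (subst rsa_occupied.simps) simp
  then show ?thesis by simp
qed

lemma measurable_rsa_state:
  assumes "countable V" "\<And>w. w \<in> V \<Longrightarrow> X w \<in> borel_measurable N"
  shows "(\<lambda>\<omega>. rsa_state V E (\<lambda>u. X u \<omega>) t v) \<in> measurable N (count_space UNIV)"
  unfolding rsa_state_eq_THE_eventually[OF assms(1)]
proof (rule measurable_THE[where I = UNIV])
  fix x :: nat
  let ?fin = "{F. finite F \<and> F \<subseteq> V}"
  have fin: "countable ?fin"
    using countable_Collect_finite_subset[OF assms(1)] by (simp add: conj_commute)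
  have "Measurable.pred N (\<lambda>\<omega>. \<exists>F\<in>?fin. \<forall>G\<in>?fin. F \<subseteq> G \<longrightarrow>
      of_bool (rsa_occupied G E (\<lambda>u. X u \<omega>) t v) = x)"
    unfolding pred_def
  proof (intro sets.sets_Collect_countable_Ex' sets.sets_Collect_countable_All' fin)
    fix F G
    assume "G \<in> ?fin"
    then have [measurable]: "Measurable.pred N (\<lambda>\<omega>. rsa_occupied G E (\<lambda>u. X u \<omega>) t v)"
      using assms(2) by (intro measurable_rsa_occupied) auto
    show "{\<omega> \<in> space N. F \<subseteq> G \<longrightarrow> of_bool (rsa_occupied G E (\<lambda>u. X u \<omega>) t v) = x} \<in> sets N"
      unfolding of_bool_def by measurable
  qed
  moreover have "(\<exists>F\<in>?fin. \<forall>G\<in>?fin. F \<subseteq> G \<longrightarrow> of_bool (rsa_occupied G E (\<lambda>u. X u \<omega>) t v) = x)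
    \<longleftrightarrow> eventually (\<lambda>G. of_bool (rsa_occupied G E (\<lambda>u. X u \<omega>) t v) = x) (finite_subsets_at_top V)"
    for \<omega>
    unfolding eventually_finite_subsets_at_top by blast
  ultimately show "Measurable.pred N (\<lambda>\<omega>. eventually
      (\<lambda>G. of_bool (rsa_occupied G E (\<lambda>u. X u \<omega>) t v) = x) (finite_subsets_at_top V))"
    by simp
next
  fix \<omega> and x y :: nat
  assume "eventually (\<lambda>G. of_bool (rsa_occupied G E (\<lambda>u. X u \<omega>) t v) = x) (finite_subsets_at_top V)"
    "eventually (\<lambda>G. of_bool (rsa_occupied G E (\<lambda>u. X u \<omega>) t v) = y) (finite_subsets_at_top V)"
  then have "eventually (\<lambda>G. x = y) (finite_subsets_at_top V)"
    by eventually_elim simp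
  then show "x = y"
    by (simp add: eventually_const)
qed auto


section \<open>Dynamics when every arrival has finitely many causes\<close>

definition earlier_neighbour :: "'a set \<Rightarrow> 'a rel \<Rightarrow> ('a \<Rightarrow> real) \<Rightarrow> 'a rel" where
  "earlier_neighbour V E \<tau> = {(w, v). v \<in> V \<and> w \<in> V \<and> (v, w) \<in> E \<and> \<tau> w < \<tau> v}"

definition well_founded_arrivals :: "'a set \<Rightarrow> 'a rel \<Rightarrow> ('a \<Rightarrow> real) \<Rightarrow> bool" where
  "well_founded_arrivals V E \<tau> \<longleftrightarrow>
     countable V \<and> (\<forall>v\<in>V. finite (E `` {v})) \<and> wf (earlier_neighbour V E \<tau>)"

lemma well_founded_arrivals_subset:
  "well_founded_arrivals V E \<tau> \<Longrightarrow> U \<subseteq> V \<Longrightarrow> well_founded_arrivals U E \<tau>"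
  unfolding well_founded_arrivals_def
  by (auto intro: countable_subset elim!: wf_subset simp: earlier_neighbour_def)

text \<open>
  By well-founded induction along earlier neighbours, the fate of \<open>v\<close> is the same in all
  large finite subgraphs: it is determined by the fates of its earlier neighbours, which are
  finitely many and already settled.
\<close>

lemma rsa_occupied_settles:
  assumes "well_founded_arrivals V E \<tau>" "v \<in> V"
  shows "\<exists>b. eventually (\<lambda>G. rsa_occupied G E \<tau> (\<tau> v) v \<longleftrightarrow> b) (finite_subsets_at_top V)"
proof -
  have "wf (earlier_neighbour V E \<tau>)"
    using assms(1) by (simp add: well_founded_arrivals_def)
  then show ?thesis
    using assms(2)
  proof (induction v rule: wf_induct_rule)
    case (less v)
    define N where "N = {w \<in> V. (v, w) \<in> E \<and> \<tau> w < \<tau> v}"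
    have finN: "finite N"
      by (rule finite_subset[of _ "E `` {v}"])
        (use assms(1) less.prems in \<open>auto simp: N_def well_founded_arrivals_def\<close>)
    have "\<forall>w\<in>N. \<exists>b. eventually (\<lambda>G. rsa_occupied G E \<tau> (\<tau> w) w \<longleftrightarrow> b) (finite_subsets_at_top V)"
      using less by (auto simp: N_def earlier_neighbour_def)
    then obtain b where b: "\<And>w. w \<in> N \<Longrightarrow>
        eventually (\<lambda>G. rsa_occupied G E \<tau> (\<tau> w) w \<longleftrightarrow> b w) (finite_subsets_at_top V)"
      by metis
    have "eventually (\<lambda>G. \<forall>w\<in>N. rsa_occupied G E \<tau> (\<tau> w) w \<longleftrightarrow> b w) (finite_subsets_at_top V)"
      using b finN by (simp add: eventually_ball_finite)
    moreover have "eventually (\<lambda>G. finite G \<and> insert v N \<subseteq> G \<and> G \<subseteq> V) (finite_subsets_at_top V)"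
      unfolding eventually_finite_subsets_at_top
      by (rule exI[of _ "insert v N"]) (use finN less.prems in \<open>auto simp: N_def\<close>)
    ultimately have "eventually (\<lambda>G. rsa_occupied G E \<tau> (\<tau> v) v \<longleftrightarrow> (\<forall>w\<in>N. \<not> b w))
        (finite_subsets_at_top V)"
    proof eventually_elim
      case (elim G)
      then show ?case
        by (subst rsa_occupied_at_arrival) (auto simp: N_def)
    qed
    then show ?case by blast
  qed
qed

lemma rsa_state_settles:
  assumes "well_founded_arrivals V E \<tau>" "v \<in> V"
  shows "eventually (\<lambda>G. rsa_occupied G E \<tau> t v \<longleftrightarrow> rsa_state V E \<tau> t v \<noteq> 0)
    (finite_subsets_at_top V)"
proof -
  obtain b where "eventually (\<lambda>G. rsa_occupied G E \<tau> (\<tau> v) v \<longleftrightarrow> b) (finite_subsets_at_top V)"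
    using rsa_occupied_settles[OF assms] by blast
  then have *: "eventually (\<lambda>G. rsa_occupied G E \<tau> t v \<longleftrightarrow> \<tau> v \<le> t \<and> b) (finite_subsets_at_top V)"
    by eventually_elim (subst rsa_occupied_iff_arrived, simp)
  moreover have "countable V"
    using assms(1) by (simp add: well_founded_arrivals_def)
  ultimately have "rsa_state V E \<tau> t v = of_bool (\<tau> v \<le> t \<and> b)"
    by (intro rsa_state_eqI)
  with * show ?thesis by simp
qed

text \<open>
  The defining rule of the finite process passes to the limit, and all later statements about
  single realisations are derived from it.
\<close>

lemma rsa_state_occupied_iff:
  assumes "well_founded_arrivals V E \<tau>" "v \<in> V"
  shows "rsa_state V E \<tau> t v \<noteq> 0 \<longleftrightarrow>
    \<tau> v \<le> t \<and> (\<forall>w\<in>V. (v, w) \<in> E \<and> \<tau> w < \<tau> v \<longrightarrow> rsa_state V E \<tau> (\<tau> v) w = 0)"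
proof -
  define N where "N = {w \<in> V. (v, w) \<in> E \<and> \<tau> w < \<tau> v}"
  have finN: "finite N"
    by (rule finite_subset[of _ "E `` {v}"])
      (use assms in \<open>auto simp: N_def well_founded_arrivals_def\<close>)
  have "\<And>w. w \<in> N \<Longrightarrow> eventually (\<lambda>G. rsa_occupied G E \<tau> (\<tau> v) w \<longleftrightarrow> rsa_state V E \<tau> (\<tau> v) w \<noteq> 0)
      (finite_subsets_at_top V)"
    using rsa_state_settles[OF assms(1)] by (simp add: N_def)
  then have "eventually (\<lambda>G. \<forall>w\<in>N. rsa_occupied G E \<tau> (\<tau> v) w \<longleftrightarrow> rsa_state V E \<tau> (\<tau> v) w \<noteq> 0)
      (finite_subsets_at_top V)"
    using finN by (simp add: eventually_ball_finite)
  moreover have "eventually (\<lambda>G. finite G \<and> insert v N \<subseteq> G \<and> G \<subseteq> V) (finite_subsets_at_top V)"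
    unfolding eventually_finite_subsets_at_top
    by (rule exI[of _ "insert v N"]) (use finN assms(2) in \<open>auto simp: N_def\<close>)
  moreover note rsa_state_settles[OF assms, of t]
  ultimately have "eventually (\<lambda>G. rsa_state V E \<tau> t v \<noteq> 0 \<longleftrightarrow>
      \<tau> v \<le> t \<and> (\<forall>w\<in>N. rsa_state V E \<tau> (\<tau> v) w = 0)) (finite_subsets_at_top V)"
  proof eventually_elim
    case (elim G)
    have "rsa_occupied G E \<tau> t v \<longleftrightarrow> \<tau> v \<le> t \<and> (\<forall>w\<in>N. \<not> rsa_occupied G E \<tau> (\<tau> v) w)"
      using elim(2) by (subst rsa_occupied.simps) (auto simp: N_def)
    then show ?case
      using elim by auto
  qed
  then show ?thesis
    by (simp add: eventually_const N_def) blast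
qed

lemma rsa_state_vacant_before_arrival:
  assumes "well_founded_arrivals V E \<tau>" "v \<in> V" "t < \<tau> v"
  shows "rsa_state V E \<tau> t v = 0"
  using rsa_state_occupied_iff[OF assms(1,2), of t] assms(3) by auto

lemma rsa_state_vacant_antimono:
  assumes "well_founded_arrivals V E \<tau>" "v \<in> V" "rsa_state V E \<tau> t v = 0" "s \<le> t"
  shows "rsa_state V E \<tau> s v = 0"
  using rsa_state_occupied_iff[OF assms(1,2)] assms(3,4) by (metis order_trans)

lemma rsa_state_vacant_unless_arrival:
  assumes "well_founded_arrivals V E \<tau>" "v \<in> V" "rsa_state V E \<tau> s v = 0" "\<tau> v \<notin> {s<..t}"
  shows "rsa_state V E \<tau> t v = 0"
proof (cases "\<tau> v \<le> t")
  case True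
  then have "\<tau> v \<le> s"
    using assms(4) by auto
  then show ?thesis
    using rsa_state_occupied_iff[OF assms(1,2)] assms(3) by metis
next
  case False
  then show ?thesis
    using rsa_state_vacant_before_arrival[OF assms(1,2)] by simp
qed

text \<open>Before its arrival, a site is vacant and so blocks nobody: it may as well be absent.\<close>

lemma rsa_state_delete_unarrived:
  assumes "well_founded_arrivals V E \<tau>" "w \<in> V - {v}" "s < \<tau> v"
  shows "rsa_state (V - {v}) E \<tau> s w = 0 \<longleftrightarrow> rsa_state V E \<tau> s w = 0"
proof -
  have wf': "well_founded_arrivals (V - {v}) E \<tau>"
    using assms(1) by (rule well_founded_arrivals_subset) auto
  have "wf (earlier_neighbour V E \<tau>)"
    using assms(1) by (simp add: well_founded_arrivals_def)
  then show ?thesis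
    using assms(2,3)
  proof (induction w arbitrary: s rule: wf_induct_rule)
    case (less w)
    show ?case
    proof (cases "\<tau> w \<le> s")
      case True
      have "rsa_state (V - {v}) E \<tau> (\<tau> w) u = 0 \<longleftrightarrow> rsa_state V E \<tau> (\<tau> w) u = 0"
        if "u \<in> V - {v}" "(w, u) \<in> E" "\<tau> u < \<tau> w" for u
        using less that True by (auto simp: earlier_neighbour_def)
      moreover have "u \<in> V - {v}" if "u \<in> V" "\<tau> u < \<tau> w" for u
        using that True less.prems by auto
      ultimately show ?thesis
        using rsa_state_occupied_iff[OF wf', of w s] rsa_state_occupied_iff[OF assms(1), of w s]
          less.prems by (metis DiffD1)
    next
      case False
      then show ?thesis
        using rsa_state_vacant_before_arrival[OF wf', of w s]
          rsa_state_vacant_before_arrival[OF assms(1), of w s] less.prems by simp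
    qed
  qed
qed

text \<open>
  The right-hand side is an event for the clock of \<open>v\<close> and an event for the process without \<open>v\<close>,
  which makes it computable by independence. If \<open>v\<close> gets occupied during \<open>(s, t]\<close>, then at that
  moment no neighbour was occupied, hence none was at time \<open>s\<close>, and until its own arrival \<open>v\<close>
  influences nobody. Conversely, \<open>v\<close> can only be refused by a neighbour that got occupied
  after time \<open>s\<close>, and this would be a second arrival in \<open>S\<close> during \<open>(s, t]\<close>.
\<close>

lemma first_occupation_iff:
  assumes wf: "well_founded_arrivals V E \<tau>"
    and "W \<subseteq> V"
    and S: "W \<subseteq> S" "\<And>v w. v \<in> W \<Longrightarrow> w \<in> V \<Longrightarrow> (v, w) \<in> E \<Longrightarrow> w \<in> S"
    and single: "\<And>u w. u \<in> S \<Longrightarrow> w \<in> S \<Longrightarrow> \<tau> u \<in> {s<..t} \<Longrightarrow> \<tau> w \<in> {s<..t} \<Longrightarrow> u = w"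
  shows "(\<forall>w\<in>W. rsa_state V E \<tau> s w = 0) \<and> \<not> (\<forall>w\<in>W. rsa_state V E \<tau> t w = 0) \<longleftrightarrow>
    (\<exists>v\<in>W. \<tau> v \<in> {s<..t} \<and>
      (\<forall>w\<in>(W \<union> {w \<in> V. (v, w) \<in> E}) - {v}. rsa_state (V - {v}) E \<tau> s w = 0))"
    (is "?L \<longleftrightarrow> (\<exists>v\<in>W. ?R v)")
proof
  assume L: ?L
  then obtain v where v: "v \<in> W" "rsa_state V E \<tau> t v \<noteq> 0"
    by blast
  then have vV: "v \<in> V"
    using \<open>W \<subseteq> V\<close> by auto
  have arr: "\<tau> v \<in> {s<..t}"
    using rsa_state_vacant_unless_arrival[OF wf vV, of s t] L v by auto
  have "rsa_state (V - {v}) E \<tau> s w = 0" if w: "w \<in> (W \<union> {w \<in> V. (v, w) \<in> E}) - {v}" for w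
  proof -
    have wV: "w \<in> V - {v}"
      using w \<open>W \<subseteq> V\<close> by auto
    have "rsa_state V E \<tau> s w = 0"
    proof (cases "w \<in> W \<or> s < \<tau> w")
      case True
      then show ?thesis
        using L rsa_state_vacant_before_arrival[OF wf, of w s] wV by auto
    next
      case False
      then have "rsa_state V E \<tau> (\<tau> v) w = 0"
        using rsa_state_occupied_iff[OF wf vV, of t] v(2) w wV arr by auto
      then show ?thesis
        using rsa_state_vacant_antimono[OF wf, of w "\<tau> v" s] wV arr by auto
    qed
    then show ?thesis
      using rsa_state_delete_unarrived[OF wf wV] arr by auto
  qed
  with v arr show "\<exists>v\<in>W. ?R v"
    by blast
next
  assume "\<exists>v\<in>W. ?R v"
  then obtain v where v: "v \<in> W" and R: "?R v"
    by blast
  then have vV: "v \<in> V" and sv: "s < \<tau> v" "\<tau> v \<le> t"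
    using \<open>W \<subseteq> V\<close> by auto
  have vac: "rsa_state V E \<tau> s w = 0" if "w \<in> W \<union> {w \<in> V. (v, w) \<in> E}" for w
  proof (cases "w = v")
    case True
    then show ?thesis
      using rsa_state_vacant_before_arrival[OF wf vV sv(1)] by simp
  next
    case False
    then have "w \<in> V - {v}"
      using that \<open>W \<subseteq> V\<close> by auto
    then show ?thesis
      using rsa_state_delete_unarrived[OF wf _ sv(1)] R that False by blast
  qed
  have "rsa_state V E \<tau> (\<tau> v) w = 0" if w: "w \<in> V" "(v, w) \<in> E" "\<tau> w < \<tau> v" for w
  proof (rule rsa_state_vacant_unless_arrival[OF wf w(1), of s])
    show "rsa_state V E \<tau> s w = 0"
      using vac w by blast
    show "\<tau> w \<notin> {s<..\<tau> v}"
      using single[of v w] S v w sv by fastforce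
  qed
  then have "rsa_state V E \<tau> t v \<noteq> 0"
    using rsa_state_occupied_iff[OF wf vV, of t] sv by blast
  with v vac show ?L
    by auto
qed


section \<open>Almost sure absence of infinite descending chains of arrivals\<close>

primrec walks :: "'a rel \<Rightarrow> nat \<Rightarrow> 'a \<Rightarrow> 'a list set" where
  "walks E 0 v = {[v]}"
| "walks E (Suc n) v = (\<Union>w\<in>E `` {v}. (#) v ` walks E n w)"

lemma length_walks: "xs \<in> walks E n v \<Longrightarrow> length xs = Suc n"
  by (induction n arbitrary: v xs) auto

lemma set_walks: "xs \<in> walks E n v \<Longrightarrow> E \<subseteq> V \<times> V \<Longrightarrow> v \<in> V \<Longrightarrow> set xs \<subseteq> V"
  by (induction n arbitrary: v xs) fastforce+

lemma map_upt_in_walks: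
  assumes "\<And>i. (f i, f (Suc i)) \<in> E"
  shows "map f [k..<k + Suc n] \<in> walks E n (f k)"
proof (induction n arbitrary: k)
  case (Suc n)
  have "map f [k..<k + Suc (Suc n)] = f k # map f [Suc k..<Suc k + Suc n]"
    by (subst upt_conv_Cons) (auto simp del: upt_Suc)
  then show ?case
    using Suc[of "Suc k"] assms[of k] by (auto simp del: upt_Suc)
qed simp

lemma finite_card_walks:
  assumes deg: "\<And>v. v \<in> V \<Longrightarrow> finite (E `` {v}) \<and> card (E `` {v}) \<le> d"
    and "E \<subseteq> V \<times> V" "v \<in> V"
  shows "finite (walks E n v) \<and> card (walks E n v) \<le> d ^ n"
  using \<open>v \<in> V\<close>
proof (induction n arbitrary: v)
  case (Suc n)
  have IH: "finite (walks E n w) \<and> card (walks E n w) \<le> d ^ n" if "w \<in> E `` {v}" for w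
    using Suc.IH that assms(2) by blast
  have "card (walks E (Suc n) v) \<le> (\<Sum>w\<in>E `` {v}. card ((#) v ` walks E n w))"
    using deg[OF Suc.prems] by (simp add: card_UN_le)
  also have "\<dots> \<le> (\<Sum>w\<in>E `` {v}. d ^ n)"
  proof (rule sum_mono)
    fix w
    assume "w \<in> E `` {v}"
    then show "card ((#) v ` walks E n w) \<le> d ^ n"
      using IH[of w] card_image_le[of "walks E n w" "(#) v"] by linarith
  qed
  also have "\<dots> \<le> d ^ Suc n"
    using deg[OF Suc.prems] by simp
  finally show ?case
    using deg[OF Suc.prems] IH by auto
qed simp

locale uniform_arrivals = prob_space M for M :: "'b measure" +
  fixes V :: "'a set" and E :: "'a rel" and \<tau> :: "'a \<Rightarrow> 'b \<Rightarrow> real"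
  assumes countable_sites: "countable V"
    and edges: "E \<subseteq> V \<times> V"
    and bounded_deg: "bounded_degree V E"
    and indep_arrivals: "indep_vars (\<lambda>_. borel) \<tau> V"
    and uniform_arrival: "\<And>v. v \<in> V \<Longrightarrow> distr M borel (\<tau> v) = uniform_measure lborel {0<..<1}"
begin

lemma measurable_arrival [measurable]: "v \<in> V \<Longrightarrow> \<tau> v \<in> borel_measurable M"
  using indep_arrivals by (simp add: indep_vars_def)

lemma prob_arrival:
  assumes "v \<in> V" "0 \<le> a" "a \<le> b" "b \<le> 1"
  shows "prob {\<omega> \<in> space M. \<tau> v \<omega> \<in> {a<..b}} = b - a"
proof -
  have "prob {\<omega> \<in> space M. \<tau> v \<omega> \<in> {a<..b}} = measure (distr M borel (\<tau> v)) {a<..b}"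
    using assms(1) by (subst measure_distr) (auto simp: vimage_def Int_def conj_commute)
  also have "\<dots> = measure lborel ({0<..<1} \<inter> {a<..b})"
    using uniform_arrival[OF assms(1)] by simp
  also have "{0<..<1} \<inter> {a<..b} = (if b = 1 then {a<..<b} else {a<..b})"
    using assms by auto
  finally show ?thesis
    using assms by (auto split: if_splits)
qed

lemma prob_all_arrive:
  assumes "finite J" "J \<subseteq> V" "0 \<le> a" "a \<le> b" "b \<le> 1"
  shows "prob {\<omega> \<in> space M. \<forall>u\<in>J. \<tau> u \<omega> \<in> {a<..b}} = (b - a) ^ card J"
proof (cases "J = {}")
  case False
  have "{\<omega> \<in> space M. \<forall>u\<in>J. \<tau> u \<omega> \<in> {a<..b}} = (\<Inter>u\<in>J. \<tau> u -` {a<..b} \<inter> space M)"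
    using False by auto
  also have "prob \<dots> = (\<Prod>u\<in>J. prob (\<tau> u -` {a<..b} \<inter> space M))"
    using False assms by (intro indep_varsD[OF indep_arrivals]) auto
  also have "\<dots> = (\<Prod>u\<in>J. b - a)"
  proof (rule prod.cong)
    fix u
    assume "u \<in> J"
    moreover have "\<tau> u -` {a<..b} \<inter> space M = {\<omega> \<in> space M. \<tau> u \<omega> \<in> {a<..b}}"
      by auto
    ultimately show "prob (\<tau> u -` {a<..b} \<inter> space M) = b - a"
      using prob_arrival[of u a b] assms by auto
  qed simp
  finally show ?thesis by simp
qed (simp add: prob_space)

text \<open>
  A chain of \<open>n + 1\<close> arrivals starting at \<open>v\<close> with decreasing times follows one of at most \<open>d ^ n\<close>
  walks and visits \<open>n + 1\<close> different sites. All of them arrive in a given interval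
  of length \<open>\<delta>\<close> with probability \<open>\<delta> ^ (n + 1)\<close>, so chains that stay in the interval die out if \<open>d \<delta> < 1\<close>.
\<close>

lemma AE_no_descent_in_short_interval:
  assumes deg: "\<And>v. v \<in> V \<Longrightarrow> finite (E `` {v}) \<and> card (E `` {v}) \<le> d"
    and "v \<in> V" "0 \<le> a" "a \<le> b" "b \<le> 1" and short: "real d * (b - a) < 1"
  shows "AE \<omega> in M. \<nexists>f. f 0 = v \<and> (\<forall>i. (f i, f (Suc i)) \<in> E \<and>
    \<tau> (f (Suc i)) \<omega> < \<tau> (f i) \<omega> \<and> \<tau> (f i) \<omega> \<in> {a<..b})"
proof -
  define D where "D n = {xs \<in> walks E n v. distinct xs}" for n
  define B where "B n = (\<Union>xs\<in>D n. {\<omega> \<in> space M. \<forall>u\<in>set xs. \<tau> u \<omega> \<in> {a<..b}})" for n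
  have finD: "finite (D n)" and cardD: "card (D n) \<le> d ^ n" for n
    using finite_card_walks[OF deg edges \<open>v \<in> V\<close>, of n]
      card_mono[of "walks E n v" "D n"] by (auto simp: D_def)
  have D: "set xs \<subseteq> V" "card (set xs) = Suc n" if "xs \<in> D n" for xs n
    using that set_walks[OF _ edges \<open>v \<in> V\<close>] length_walks
    by (auto simp: D_def distinct_card)
  have ev: "{\<omega> \<in> space M. \<forall>u\<in>set xs. \<tau> u \<omega> \<in> {a<..b}} \<in> events" if "xs \<in> D n" for xs n
  proof -
    have [measurable]: "\<tau> u \<in> borel_measurable M" if "u \<in> set xs" for u
      using D(1)[OF \<open>xs \<in> D n\<close>] that by auto
    show ?thesis by measurable
  qed
  have B[measurable]: "B n \<in> events" for n
    unfolding B_def using finD ev by auto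
  have probB: "prob (B n) \<le> (real d * (b - a)) ^ n" for n
  proof -
    have "prob (B n) \<le> (\<Sum>xs\<in>D n. prob {\<omega> \<in> space M. \<forall>u\<in>set xs. \<tau> u \<omega> \<in> {a<..b}})"
      unfolding B_def using finD ev by (intro finite_measure_subadditive_finite) auto
    also have "\<dots> = (\<Sum>xs\<in>D n. (b - a) ^ Suc n)"
    proof (rule sum.cong)
      fix xs
      assume "xs \<in> D n"
      then show "prob {\<omega> \<in> space M. \<forall>u\<in>set xs. \<tau> u \<omega> \<in> {a<..b}} = (b - a) ^ Suc n"
        using prob_all_arrive[of "set xs" a b] D[of xs n] assms by simp
    qed simp
    also have "\<dots> = real (card (D n)) * (b - a) ^ Suc n"
      by simp
    also have "\<dots> \<le> real (d ^ n) * (b - a) ^ n"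
      using cardD[of n] assms power_decreasing[of n "Suc n" "b - a"]
      by (intro mult_mono) (auto simp del: power_Suc)
    finally show ?thesis
      by (simp add: power_mult_distrib)
  qed
  have "prob (\<Inter>n. B n) \<le> (real d * (b - a)) ^ n" for n
    by (rule order_trans[OF finite_measure_mono probB[of n]]) auto
  moreover have "(\<lambda>n. (real d * (b - a)) ^ n) \<longlonglongrightarrow> 0"
    using assms by (intro LIMSEQ_realpow_zero) auto
  ultimately have "prob (\<Inter>n. B n) \<le> 0"
    by (intro LIMSEQ_le_const[where X = "\<lambda>n. (real d * (b - a)) ^ n"]) auto
  then have "(\<Inter>n. B n) \<in> null_sets M"
    by (intro null_setsI) (auto simp: emeasure_eq_measure measure_le_0_iff)
  then show ?thesis
  proof (rule AE_I')
    show "{\<omega> \<in> space M. \<not> (\<nexists>f. f 0 = v \<and> (\<forall>i. (f i, f (Suc i)) \<in> E \<and>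
      \<tau> (f (Suc i)) \<omega> < \<tau> (f i) \<omega> \<and> \<tau> (f i) \<omega> \<in> {a<..b}))} \<subseteq> (\<Inter>n. B n)" (is "?bad \<subseteq> _")
    proof (intro subsetI INT_I)
      fix \<omega> n
      assume "\<omega> \<in> ?bad"
      then obtain f where "\<omega> \<in> space M" and v: "f 0 = v"
        and f: "\<And>i. (f i, f (Suc i)) \<in> E" "\<And>i. \<tau> (f (Suc i)) \<omega> < \<tau> (f i) \<omega>"
          "\<And>i. \<tau> (f i) \<omega> \<in> {a<..b}"
        by blast
      have "\<tau> (f j) \<omega> < \<tau> (f i) \<omega>" if "i < j" for i j
        using lift_Suc_mono_less[of "\<lambda>i. - \<tau> (f i) \<omega>" i j] f that by simp
      then have "inj f"
        by (metis injI linorder_neqE_nat less_irrefl)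
      then have "map f [0..<0 + Suc n] \<in> D n"
        using map_upt_in_walks[of f E 0 n] f v
        by (auto simp: D_def distinct_map simp del: upt_Suc intro: inj_on_subset)
      then show "\<omega> \<in> B n"
        unfolding B_def using f \<open>\<omega> \<in> space M\<close> by (intro UN_I) auto
    qed
  qed
qed

text \<open>
  Cut \<open>(0, 1]\<close> into finitely many short intervals. An infinite descending chain ends up in the
  lowest interval that it meets, and almost surely no infinite chain stays in a short interval.
\<close>

lemma AE_well_founded_arrivals:
  "AE \<omega> in M. well_founded_arrivals V E (\<lambda>u. \<tau> u \<omega>)"
proof -
  obtain d where deg: "\<And>v. v \<in> V \<Longrightarrow> finite (E `` {v}) \<and> card (E `` {v}) \<le> d"
    using bounded_deg by (auto simp: bounded_degree_def)
  (* More than d intervals, so that d times their length stays below 1. *)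
  define K where "K = real (Suc d)"
  have K: "K > 0"
    by (simp add: K_def)
  have slab: "AE \<omega> in M. \<nexists>f. f 0 = v \<and> (\<forall>i. (f i, f (Suc i)) \<in> E \<and>
      \<tau> (f (Suc i)) \<omega> < \<tau> (f i) \<omega> \<and> \<tau> (f i) \<omega> \<in> {real j / K<..real (Suc j) / K})"
    if "v \<in> V" "j \<in> {..d}" for v j
    using that K
    by (intro AE_no_descent_in_short_interval[OF deg])
      (auto simp: K_def divide_simps simp flip: diff_divide_distrib)
  have "AE \<omega> in M. \<tau> v \<omega> \<in> {0<..1}" if [measurable]: "v \<in> V" for v
    using prob_arrival[OF that, of 0 1] AE_prob_1[of "{\<omega> \<in> space M. \<tau> v \<omega> \<in> {0<..1}}"] by simp
  then have "AE \<omega> in M. \<forall>v\<in>V. \<tau> v \<omega> \<in> {0<..1}"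
    using countable_sites by (simp add: AE_ball_countable)
  moreover have "AE \<omega> in M. \<forall>v\<in>V. \<forall>j\<in>{..d}. \<nexists>f. f 0 = v \<and> (\<forall>i. (f i, f (Suc i)) \<in> E \<and>
      \<tau> (f (Suc i)) \<omega> < \<tau> (f i) \<omega> \<and> \<tau> (f i) \<omega> \<in> {real j / K<..real (Suc j) / K})"
    using slab countable_sites by (intro AE_ball_countable') auto
  ultimately show ?thesis
  proof eventually_elim
    case (elim \<omega>)
    have "\<not> (\<forall>i. (f (Suc i), f i) \<in> earlier_neighbour V E (\<lambda>u. \<tau> u \<omega>))" for f
    proof
      assume "\<forall>i. (f (Suc i), f i) \<in> earlier_neighbour V E (\<lambda>u. \<tau> u \<omega>)"
      then have f: "f i \<in> V" "(f i, f (Suc i)) \<in> E" "\<tau> (f (Suc i)) \<omega> < \<tau> (f i) \<omega>" for i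
        by (auto simp: earlier_neighbour_def)
      define P where "P j \<longleftrightarrow> (\<exists>i. \<tau> (f i) \<omega> \<le> real (Suc j) / K)" for j
      have "\<tau> (f 0) \<omega> \<le> real (Suc d) / K"
        using elim(1) f(1)[of 0] by (simp add: K_def)
      then have "P d"
        unfolding P_def by blast
      (* The lowest interval that the chain meets; its lower end is never passed. *)
      define j where "j = (LEAST j. P j)"
      have j: "P j" "j \<le> d"
        unfolding j_def using \<open>P d\<close> by (auto intro: LeastI Least_le)
      obtain i where i: "\<tau> (f i) \<omega> \<le> real (Suc j) / K"
        using j(1) by (auto simp: P_def)
      have upper: "\<tau> (f (i + k)) \<omega> \<le> real (Suc j) / K" for k
      proof (induction k)
        case (Suc k)
        then show ?case
          using f(3)[of "i + k"] by simp
      qed (use i in simp)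
      have lower: "real j / K < \<tau> (f (i + k)) \<omega>" for k
      proof (cases j)
        case 0
        then show ?thesis
          using elim(1) f(1) by simp
      next
        case (Suc j')
        then have "\<not> P j'"
          unfolding j_def by (metis lessI not_less_Least)
        then show ?thesis
          using Suc by (auto simp: P_def not_le)
      qed
      have no_chain: "\<not> (g 0 = f i \<and> (\<forall>k. (g k, g (Suc k)) \<in> E \<and>
          \<tau> (g (Suc k)) \<omega> < \<tau> (g k) \<omega> \<and> \<tau> (g k) \<omega> \<in> {real j / K<..real (Suc j) / K}))" for g
        using elim(2) f(1)[of i] j(2) by blast
      have "f (i + 0) = f i \<and> (\<forall>k. (f (i + k), f (i + Suc k)) \<in> E \<and>
          \<tau> (f (i + Suc k)) \<omega> < \<tau> (f (i + k)) \<omega> \<and>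
          \<tau> (f (i + k)) \<omega> \<in> {real j / K<..real (Suc j) / K})"
        using f(2,3) upper lower by simp
      then show False
        using no_chain[of "\<lambda>k. f (i + k)"] by blast
    qed
    then show ?case
      using countable_sites deg
      by (auto simp: well_founded_arrivals_def wf_iff_no_infinite_down_chain)
  qed
qed


section \<open>Increments of the vacancy probability\<close>

abbreviation vacant :: "'a set \<Rightarrow> 'a set \<Rightarrow> real \<Rightarrow> 'b set" where
  "vacant U S t \<equiv> {\<omega> \<in> space M. \<forall>w\<in>S. rsa_state U E (\<lambda>u. \<tau> u \<omega>) t w = 0}"

abbreviation arrives :: "'a \<Rightarrow> real \<Rightarrow> real \<Rightarrow> 'b set" where
  "arrives v s t \<equiv> {\<omega> \<in> space M. \<tau> v \<omega> \<in> {s<..t}}"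

lemma vacant_event:
  assumes "U \<subseteq> V" "finite S"
  shows "vacant U S t \<in> events"
proof -
  have [measurable]: "(\<lambda>\<omega>. rsa_state U E (\<lambda>u. \<tau> u \<omega>) t w) \<in> measurable M (count_space UNIV)" for w
    using assms(1) countable_sites
    by (intro measurable_rsa_state) (auto intro: countable_subset)
  show ?thesis
    using assms(2) by measurable
qed

lemma arrives_event: "v \<in> V \<Longrightarrow> arrives v s t \<in> events"
  by measurable

text \<open>The process on \<open>V - {v}\<close> does not look at the clock of \<open>v\<close>.\<close>

lemma prob_arrives_vacant:
  assumes "v \<in> V" "finite S" "0 \<le> s" "s \<le> t" "t \<le> 1"
  shows "prob (arrives v s t \<inter> vacant (V - {v}) S s) = (t - s) * prob (vacant (V - {v}) S s)"
proof -
  define A where "A = {g \<in> space (Pi\<^sub>M {v} (\<lambda>_. borel)). g v \<in> {s<..t}}"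
  define B where "B = {g \<in> space (Pi\<^sub>M (V - {v}) (\<lambda>_. borel)).
    \<forall>w\<in>S. rsa_state (V - {v}) E g s w = 0}"
  have cnt: "countable (V - {v})"
    using countable_sites by auto
  have A: "A \<in> sets (Pi\<^sub>M {v} (\<lambda>_. borel))"
    unfolding A_def by measurable
  have B: "B \<in> sets (Pi\<^sub>M (V - {v}) (\<lambda>_. borel))"
  proof -
    have [measurable]: "(\<lambda>g. rsa_state (V - {v}) E g s w) \<in>
        measurable (Pi\<^sub>M (V - {v}) (\<lambda>_. borel)) (count_space UNIV)" for w
      using measurable_rsa_state[OF cnt, of "\<lambda>u g. g u" "Pi\<^sub>M (V - {v}) (\<lambda>_. borel)" E s w]
      by simp
    show ?thesis
      unfolding B_def using assms(2) by measurable
  qed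
  have indep: "indep_var (Pi\<^sub>M {v} (\<lambda>_. borel)) (\<lambda>\<omega>. restrict (\<lambda>i. \<tau> i \<omega>) {v})
      (Pi\<^sub>M (V - {v}) (\<lambda>_. borel)) (\<lambda>\<omega>. restrict (\<lambda>i. \<tau> i \<omega>) (V - {v}))"
    using indep_arrivals assms(1) by (intro indep_var_restrict[where I = V]) auto
  have restr: "rsa_state (V - {v}) E (restrict (\<lambda>i. \<tau> i \<omega>) (V - {v})) s w =
      rsa_state (V - {v}) E (\<lambda>i. \<tau> i \<omega>) s w" for \<omega> w
    by (rule rsa_state_cong[OF cnt]) simp
  have A_eq: "(\<lambda>\<omega>. restrict (\<lambda>i. \<tau> i \<omega>) {v}) -` A \<inter> space M = arrives v s t"
    by (auto simp: A_def space_PiM)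
  have B_eq: "(\<lambda>\<omega>. restrict (\<lambda>i. \<tau> i \<omega>) (V - {v})) -` B \<inter> space M = vacant (V - {v}) S s"
    by (auto simp: B_def space_PiM restr)
  have "arrives v s t \<inter> vacant (V - {v}) S s =
      (\<lambda>\<omega>. (restrict (\<lambda>i. \<tau> i \<omega>) {v}, restrict (\<lambda>i. \<tau> i \<omega>) (V - {v}))) -` (A \<times> B) \<inter> space M"
    using A_eq B_eq by blast
  then show ?thesis
    using indep_varD[OF indep A B] A_eq B_eq prob_arrival[OF assms(1,3,4,5)] by simp
qed

text \<open>The states on \<open>S\<close> can only change between \<open>s\<close> and \<open>t\<close> if some site of \<open>S\<close> arrives.\<close>

lemma prob_vacant_Lipschitz:
  assumes "U \<subseteq> V" "finite S" "S \<subseteq> U" "0 \<le> s" "s \<le> t" "t \<le> 1"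
  shows "\<bar>prob (vacant U S s) - prob (vacant U S t)\<bar> \<le> real (card S) * (t - s)"
proof -
  have wf: "AE \<omega> in M. well_founded_arrivals U E (\<lambda>u. \<tau> u \<omega>)"
    using AE_well_founded_arrivals
    by eventually_elim (rule well_founded_arrivals_subset[OF _ assms(1)])
  have "S \<subseteq> V"
    using assms(1,3) by auto
  then have arr: "arrives w s t \<in> events" if "w \<in> S" for w
    using that arrives_event by blast
  then have ev: "vacant U S s \<in> events" "vacant U S t \<in> events" "(\<Union>w\<in>S. arrives w s t) \<in> events"
    using vacant_event[OF assms(1,2)] sets.finite_UN[OF assms(2), of "\<lambda>w. arrives w s t"] by simp_all
  have "prob (vacant U S t) \<le> prob (vacant U S s)"
  proof (rule finite_measure_mono_AE[OF _ ev(1)])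
    show "AE \<omega> in M. \<omega> \<in> vacant U S t \<longrightarrow> \<omega> \<in> vacant U S s"
      using wf
    proof eventually_elim
      case (elim \<omega>)
      then show ?case
        using rsa_state_vacant_antimono[OF elim _ _ \<open>s \<le> t\<close>] \<open>S \<subseteq> U\<close> by blast
    qed
  qed
  moreover have "prob (vacant U S s) \<le> prob (vacant U S t \<union> (\<Union>w\<in>S. arrives w s t))"
  proof (rule finite_measure_mono_AE)
    show "AE \<omega> in M. \<omega> \<in> vacant U S s \<longrightarrow> \<omega> \<in> vacant U S t \<union> (\<Union>w\<in>S. arrives w s t)"
      using wf
    proof eventually_elim
      case (elim \<omega>)
      then show ?case
        using rsa_state_vacant_unless_arrival[OF elim, of _ s t] \<open>S \<subseteq> U\<close> by blast
    qed
  qed (use ev in auto)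
  moreover have "\<dots> \<le> prob (vacant U S t) + prob (\<Union>w\<in>S. arrives w s t)"
    using ev by (intro measure_Un_le)
  moreover have "prob (\<Union>w\<in>S. arrives w s t) \<le> (\<Sum>w\<in>S. prob (arrives w s t))"
    using assms(2) arr by (intro finite_measure_subadditive_finite) auto
  moreover have "\<dots> = (\<Sum>w\<in>S. t - s)"
    using \<open>S \<subseteq> V\<close> assms by (intro sum.cong refl prob_arrival) auto
  ultimately show ?thesis
    by simp
qed

lemma prob_two_arrivals_le:
  assumes "finite S" "S \<subseteq> V" "0 \<le> s" "s \<le> t" "t \<le> 1"
  shows "(\<Union>u\<in>S. \<Union>w\<in>S - {u}. arrives u s t \<inter> arrives w s t) \<in> events"
    and "prob (\<Union>u\<in>S. \<Union>w\<in>S - {u}. arrives u s t \<inter> arrives w s t) \<le>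
      real (card S) ^ 2 * (t - s) ^ 2"
proof -
  have ev: "arrives u s t \<inter> arrives w s t \<in> events" if "u \<in> S" "w \<in> S" for u w
    using that assms(2) arrives_event by blast
  then show *: "(\<Union>u\<in>S. \<Union>w\<in>S - {u}. arrives u s t \<inter> arrives w s t) \<in> events"
    using assms(1) by (intro sets.finite_UN) auto
  have ev_row: "(\<Union>w\<in>S - {u}. arrives u s t \<inter> arrives w s t) \<in> events" if "u \<in> S" for u
    using that assms(1) ev by (intro sets.finite_UN) auto
  have pair: "prob (arrives u s t \<inter> arrives w s t) = (t - s) ^ 2"
    if "u \<in> S" "w \<in> S - {u}" for u w
  proof -
    have "arrives u s t \<inter> arrives w s t = {\<omega> \<in> space M. \<forall>x\<in>{u, w}. \<tau> x \<omega> \<in> {s<..t}}"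
      by auto
    moreover have "prob \<dots> = (t - s) ^ card {u, w}"
      by (rule prob_all_arrive) (use that assms in auto)
    moreover have "card {u, w} = 2"
      using that by (auto simp: card_insert_if)
    ultimately show ?thesis
      by (simp only:)
  qed
  have "prob (\<Union>u\<in>S. \<Union>w\<in>S - {u}. arrives u s t \<inter> arrives w s t)
      \<le> (\<Sum>u\<in>S. prob (\<Union>w\<in>S - {u}. arrives u s t \<inter> arrives w s t))"
    using assms(1) ev_row by (intro finite_measure_subadditive_finite image_subsetI)
  also have "\<dots> \<le> (\<Sum>u\<in>S. \<Sum>w\<in>S - {u}. prob (arrives u s t \<inter> arrives w s t))"
    using assms(1) ev by (intro sum_mono finite_measure_subadditive_finite image_subsetI) auto
  also have "\<dots> = (\<Sum>u\<in>S. \<Sum>w\<in>S - {u}. (t - s) ^ 2)"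
    by (intro sum.cong refl pair)
  also have "\<dots> \<le> (\<Sum>u\<in>S. \<Sum>w\<in>S. (t - s) ^ 2)"
    using assms(1) by (intro sum_mono sum_mono2) auto
  finally show "prob (\<Union>u\<in>S. \<Union>w\<in>S - {u}. arrives u s t \<inter> arrives w s t) \<le>
      real (card S) ^ 2 * (t - s) ^ 2"
    by (simp add: power2_eq_square mult.assoc)
qed

end

section \<open>The derivative\<close>

lemma has_real_derivative_if_quadratic_error:
  fixes p :: "real \<Rightarrow> real"
  assumes "0 \<le> t" "t < 1"
    and err: "\<And>y. 0 \<le> y \<Longrightarrow> y \<le> 1 \<Longrightarrow> \<bar>p y - p t - (y - t) * D\<bar> \<le> C * (y - t) ^ 2"
  shows "(p has_real_derivative D) (at t within {0..})"
  unfolding has_field_derivative_iff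
proof (rule LIM_zero_cancel, rule Lim_null_comparison)
  have "\<bar>(p y - p t) / (y - t) - D\<bar> \<le> C * \<bar>y - t\<bar>"
    if y: "y \<in> {0..}" "y \<noteq> t" "dist y t < 1 - t" for y
  proof -
    have "y < 1"
      using y(3) by (auto simp: dist_real_def)
    then have "\<bar>p y - p t - (y - t) * D\<bar> \<le> C * (y - t) ^ 2"
      using err y(1) by simp
    also have "\<dots> = C * \<bar>y - t\<bar> * \<bar>y - t\<bar>"
      by (simp add: power2_eq_square)
    also have "p y - p t - (y - t) * D = ((p y - p t) / (y - t) - D) * (y - t)"
      using y(2) by (simp add: field_simps)
    finally show ?thesis
      using y(2) by (simp add: abs_mult)
  qed
  then show "\<forall>\<^sub>F y in at t within {0..}. norm ((p y - p t) / (y - t) - D) \<le> C * \<bar>y - t\<bar>"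
    unfolding eventually_at using assms(2) by (intro exI[of _ "1 - t"]) auto
  show "((\<lambda>y. C * \<bar>y - t\<bar>) \<longlongrightarrow> 0) (at t within {0..})"
    by (auto intro!: tendsto_eq_intros)
qed

lemma sum_indicator_if_unique:
  assumes "finite W" "\<And>u v. u \<in> W \<Longrightarrow> v \<in> W \<Longrightarrow> x \<in> A u \<Longrightarrow> x \<in> A v \<Longrightarrow> u = v"
  shows "(\<Sum>v\<in>W. indicator (A v) x :: real) = of_bool (\<exists>v\<in>W. x \<in> A v)"
proof (cases "\<exists>v\<in>W. x \<in> A v")
  case True
  then obtain v where v: "v \<in> W" "x \<in> A v"
    by blast
  have "(\<Sum>u\<in>W. indicator (A u) x :: real) = (\<Sum>u\<in>W. if u = v then 1 else 0)"
    using assms(2) v by (intro sum.cong) (auto simp: indicator_def)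
  then show ?thesis
    using v assms(1) by auto
qed (auto simp: indicator_def)

context uniform_arrivals
begin

abbreviation occupation_rate :: "'a set \<Rightarrow> 'a \<Rightarrow> real \<Rightarrow> real" where
  "occupation_rate W v s \<equiv> prob (vacant (V - {v}) ((W \<union> {w \<in> V. (v, w) \<in> E}) - {v}) s)"

lemma finite_neighbours: "v \<in> V \<Longrightarrow> finite {w \<in> V. (v, w) \<in> E}"
  using bounded_deg by (auto simp: bounded_degree_def intro: finite_subset[of _ "E `` {v}"])

text \<open>
  Up to events with two arrivals among the finitely many sites in and next to \<open>W\<close>, which have
  probability of order \<open>(t - s)\<^sup>2\<close>, the set \<open>W\<close> loses its vacancy through exactly one site \<open>v\<close>,
  and by independence this has probability \<open>t - s\<close> times the rate of \<open>v\<close> at time \<open>s\<close>. The constant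
  \<open>C\<close> is uniform in \<open>s\<close> and \<open>t\<close>, so that the bound also gives left derivatives.
\<close>

lemma prob_vacant_increment:
  assumes "finite W" "W \<subseteq> V"
  obtains C where "\<And>s t. 0 \<le> s \<Longrightarrow> s \<le> t \<Longrightarrow> t \<le> 1 \<Longrightarrow>
    \<bar>prob (vacant V W s) - prob (vacant V W t) - (t - s) * (\<Sum>v\<in>W. occupation_rate W v s)\<bar>
      \<le> C * (t - s) ^ 2"
proof -
  define N where "N v = (W \<union> {w \<in> V. (v, w) \<in> E}) - {v}" for v
  define S where "S = W \<union> (\<Union>v\<in>W. {w \<in> V. (v, w) \<in> E})"
  have finN: "finite (N v)" if "v \<in> W" for v
    using that assms finite_neighbours by (auto simp: N_def)
  have S: "finite S" "S \<subseteq> V" "W \<subseteq> S"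
    using assms finite_neighbours by (auto simp: S_def)
  define C where "C = (1 + real (card W)) * real (card S) ^ 2"
  have "\<bar>prob (vacant V W s) - prob (vacant V W t) - (t - s) * (\<Sum>v\<in>W. occupation_rate W v s)\<bar>
      \<le> C * (t - s) ^ 2"
    if st: "0 \<le> s" "s \<le> t" "t \<le> 1" for s t
  proof -
    define A where "A v = arrives v s t \<inter> vacant (V - {v}) (N v) s" for v
    define B where "B = (\<Union>u\<in>S. \<Union>w\<in>S - {u}. arrives u s t \<inter> arrives w s t)"
    (* F vanishes off B by the pathwise description and is at most 1 + card W on B; its
       expectation is the error of the claimed increment. *)
    define F where "F \<omega> = indicator (vacant V W s) \<omega> - indicator (vacant V W t) \<omega>
      - (\<Sum>v\<in>W. indicator (A v) \<omega> :: real)" for \<omega>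
    have B: "B \<in> events" "prob B \<le> real (card S) ^ 2 * (t - s) ^ 2"
      unfolding B_def using prob_two_arrivals_le[OF S(1,2) st] by auto
    have Z: "vacant V W s \<in> events" "vacant V W t \<in> events"
      using vacant_event assms(1) by auto
    have A: "A v \<in> events" if "v \<in> W" for v
      using that assms(2) arrives_event vacant_event[OF _ finN] unfolding A_def by blast
    have probA: "prob (A v) = (t - s) * occupation_rate W v s" if "v \<in> W" for v
      using prob_arrives_vacant[OF _ finN st, of v] that assms(2) unfolding A_def N_def by blast
    have int: "integrable M (indicator (vacant V W s) :: _ \<Rightarrow> real)"
      "integrable M (indicator (vacant V W t) :: _ \<Rightarrow> real)"
      "integrable M (\<lambda>\<omega>. \<Sum>v\<in>W. indicator (A v) \<omega> :: real)"
      using Z A by (auto intro!: integrable_sum simp: emeasure_eq_measure)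
    have "expectation F = prob (vacant V W s) - prob (vacant V W t) - (\<Sum>v\<in>W. prob (A v))"
      unfolding F_def using int Z A
      by (subst Bochner_Integration.integral_diff |
          simp add: Bochner_Integration.integral_sum emeasure_eq_measure)+
    also have "(\<Sum>v\<in>W. prob (A v)) = (t - s) * (\<Sum>v\<in>W. occupation_rate W v s)"
      by (simp add: probA sum_distrib_left)
    finally have EF: "expectation F =
      prob (vacant V W s) - prob (vacant V W t) - (t - s) * (\<Sum>v\<in>W. occupation_rate W v s)" .
    have "AE \<omega> in M. \<bar>F \<omega>\<bar> \<le> (1 + real (card W)) * indicator B \<omega>"
      using AE_well_founded_arrivals AE_space
    proof eventually_elim
      case (elim \<omega>)
      have sum: "0 \<le> (\<Sum>v\<in>W. indicator (A v) \<omega> :: real)"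
        "(\<Sum>v\<in>W. indicator (A v) \<omega> :: real) \<le> real (card W)"
        using sum_bounded_above[of W "\<lambda>v. indicator (A v) \<omega> :: real" 1] by (auto intro: sum_nonneg)
      show ?case
      proof (cases "\<omega> \<in> B")
        case True
        then show ?thesis
          using sum unfolding F_def by (auto simp: indicator_def)
      next
        case False
        have single: "u = w" if "u \<in> S" "w \<in> S" "\<tau> u \<omega> \<in> {s<..t}" "\<tau> w \<omega> \<in> {s<..t}" for u w
          using False that elim(2) unfolding B_def by blast
        have "(\<Sum>v\<in>W. indicator (A v) \<omega> :: real) = of_bool (\<exists>v\<in>W. \<omega> \<in> A v)"
          using single S(3) by (intro sum_indicator_if_unique assms(1)) (auto simp: A_def)
        moreover have "(\<exists>v\<in>W. \<omega> \<in> A v) \<longleftrightarrow> \<omega> \<in> vacant V W s \<and> \<omega> \<notin> vacant V W t"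
          using first_occupation_iff[where s = s and t = t, OF elim(1) assms(2) S(3) _ single] elim(2)
          by (auto simp: A_def N_def S_def)
        moreover have "\<omega> \<in> vacant V W t \<Longrightarrow> \<omega> \<in> vacant V W s"
          using rsa_state_vacant_antimono[OF elim(1) _ _ st(2)] assms(2) by blast
        ultimately have "F \<omega> = 0"
          unfolding F_def by (auto simp: indicator_def)
        then show ?thesis
          by simp
      qed
    qed
    moreover have "integrable M F"
      unfolding F_def using int by (intro Bochner_Integration.integrable_diff)
    ultimately have "\<bar>expectation F\<bar> \<le> expectation (\<lambda>\<omega>. (1 + real (card W)) * indicator B \<omega>)"
      using B(1) by (intro order_trans[OF integral_abs_bound] integral_mono_AE integrable_abs)
        (auto simp: emeasure_eq_measure)
    also have "\<dots> = (1 + real (card W)) * prob B"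
      using B(1) by simp
    also have "\<dots> \<le> C * (t - s) ^ 2"
      unfolding C_def using B(2) by (simp add: mult.assoc mult_left_mono)
    finally show ?thesis
      by (simp add: EF)
  qed
  then show thesis
    by (rule that)
qed

lemma vacancy_derivative:
  assumes "finite W" "W \<subseteq> V" "0 \<le> t" "t < 1"
  shows "((\<lambda>s. prob (vacant V W s)) has_real_derivative - (\<Sum>v\<in>W. occupation_rate W v t))
    (at t within {0..})"
proof -
  obtain C where C: "\<And>s t. 0 \<le> s \<Longrightarrow> s \<le> t \<Longrightarrow> t \<le> 1 \<Longrightarrow>
    \<bar>prob (vacant V W s) - prob (vacant V W t) - (t - s) * (\<Sum>v\<in>W. occupation_rate W v s)\<bar>
      \<le> C * (t - s) ^ 2"
    using prob_vacant_increment[OF assms(1,2)] by blast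
  define L where "L = (\<Sum>v\<in>W. real (card ((W \<union> {w \<in> V. (v, w) \<in> E}) - {v})))"
  have "L \<ge> 0"
    unfolding L_def by (intro sum_nonneg) simp
  have L: "\<bar>(\<Sum>v\<in>W. occupation_rate W v s) - (\<Sum>v\<in>W. occupation_rate W v t)\<bar> \<le> L * (t - s)"
    if "0 \<le> s" "s \<le> t" "t \<le> 1" for s t
  proof -
    have "\<bar>(\<Sum>v\<in>W. occupation_rate W v s) - (\<Sum>v\<in>W. occupation_rate W v t)\<bar>
        \<le> (\<Sum>v\<in>W. \<bar>occupation_rate W v s - occupation_rate W v t\<bar>)"
      by (simp add: sum_subtractf[symmetric] sum_abs)
    also have "\<dots> \<le> (\<Sum>v\<in>W. real (card ((W \<union> {w \<in> V. (v, w) \<in> E}) - {v})) * (t - s))"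
      using that assms finite_neighbours
      by (intro sum_mono prob_vacant_Lipschitz) auto
    finally show ?thesis
      by (simp add: L_def sum_distrib_right)
  qed
  show ?thesis
  proof (rule has_real_derivative_if_quadratic_error[OF assms(3,4)])
    fix y :: real
    assume y: "0 \<le> y" "y \<le> 1"
    let ?p = "\<lambda>s. prob (vacant V W s)"
    let ?q = "\<lambda>s. \<Sum>v\<in>W. occupation_rate W v s"
    show "\<bar>?p y - ?p t - (y - t) * - ?q t\<bar> \<le> (C + L) * (y - t) ^ 2"
    proof (cases "t \<le> y")
      case True
      have "?p y - ?p t - (y - t) * - ?q t = - (?p t - ?p y - (y - t) * ?q t)"
        by simp
      then have "\<bar>?p y - ?p t - (y - t) * - ?q t\<bar> \<le> C * (y - t) ^ 2"
        using C[OF assms(3) True y(2)] by linarith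
      also have "\<dots> \<le> (C + L) * (y - t) ^ 2"
        using \<open>L \<ge> 0\<close> by (intro mult_right_mono) auto
      finally show ?thesis .
    next
      case False
      (* The increment formula has the rate at the left end point y; it is moved to t. *)
      have "\<bar>(t - y) * (?q y - ?q t)\<bar> \<le> (t - y) * (L * (t - y))"
        using L[of y t] False y assms(4) by (simp add: abs_mult mult_left_mono)
      moreover have "\<bar>?p y - ?p t - (t - y) * ?q y\<bar> \<le> C * (t - y) ^ 2"
        using C[of y t] False y assms(4) by simp
      moreover have "?p y - ?p t - (y - t) * - ?q t =
          (?p y - ?p t - (t - y) * ?q y) + (t - y) * (?q y - ?q t)"
        by (simp add: algebra_simps)
      moreover have "C * (t - y) ^ 2 + (t - y) * (L * (t - y)) = (C + L) * (y - t) ^ 2"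
        by (simp add: power2_eq_square algebra_simps)
      ultimately show ?thesis
        by linarith
    qed
  qed
qed

end

lemma graph_dist_le_iff:
  "graph_dist V E v w \<le> enat r \<longleftrightarrow> (\<exists>n\<le>r. (v, w) \<in> (E \<inter> V \<times> V) ^^ n)"
proof
  assume le: "graph_dist V E v w \<le> enat r"
  show "\<exists>n\<le>r. (v, w) \<in> (E \<inter> V \<times> V) ^^ n"
  proof (rule ccontr)
    assume "\<not> ?thesis"
    then have "enat (Suc r) \<le> graph_dist V E v w"
      unfolding graph_dist_def by (intro INF_greatest) (auto simp: not_less_eq_eq)
    with le have "enat (Suc r) \<le> enat r"
      by (rule order_trans[rotated])
    then show False
      by simp
  qed
next
  assume "\<exists>n\<le>r. (v, w) \<in> (E \<inter> V \<times> V) ^^ n"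
  then show "graph_dist V E v w \<le> enat r"
    unfolding graph_dist_def by (auto intro: INF_lower2)
qed

lemma nbhd_1_eq:
  assumes "v \<in> V"
  shows "nbhd 1 V E v = insert v {w \<in> V. (v, w) \<in> E}"
proof -
  have "graph_dist V E v w \<le> enat 1 \<longleftrightarrow> w = v \<or> w \<in> V \<and> (v, w) \<in> E" for w
    using assms unfolding graph_dist_le_iff by (auto simp: le_Suc_eq)
  then show ?thesis
    using assms by (auto simp: nbhd_def)
qed

theorem proposition2:
  fixes M :: "'b measure"
    and V W :: "'a set"
    and E :: "'a rel"
    and \<tau> :: "'a \<Rightarrow> 'b \<Rightarrow> real"
    and t :: real
  assumes "prob_space M"
    and "simple_graph V E"
    and "finite V \<or> (infinite V \<and> countable V \<and> bounded_degree V E)"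
    and "prob_space.indep_vars M (\<lambda>_. borel) \<tau> V"
    and "\<And>v. v \<in> V \<Longrightarrow> distr M borel (\<tau> v) = uniform_measure lborel {0<..<1}"
    and "finite W" and "W \<subseteq> V"
    and "0 \<le> t" and "t < 1"
  shows "((\<lambda>s. \<P>(\<omega> in M. \<forall>v\<in>W. rsa_state V E (\<lambda>u. \<tau> u \<omega>) s v = 0))
           has_real_derivative
           - (\<Sum>v\<in>W. \<P>(\<omega> in M. \<forall>w\<in>(W \<union> nbhd 1 V E v) - {v}.
                 rsa_state (V - {v}) E (\<lambda>u. \<tau> u \<omega>) t w = 0)))
         (at t within {0..})"
proof -
  have graph: "E \<subseteq> V \<times> V"
    using assms(2) by (auto simp: simple_graph_def)
  have "countable V"
    using assms(3) countable_finite by blast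
  moreover have "bounded_degree V E"
  proof (cases "finite V")
    case True
    have "E `` {v} \<subseteq> V" for v
      using graph by auto
    then have "finite (E `` {v}) \<and> card (E `` {v}) \<le> card V" for v
      using True by (meson card_mono finite_subset)
    then show ?thesis
      unfolding bounded_degree_def by blast
  qed (use assms(3) in auto)
  ultimately interpret uniform_arrivals M V E \<tau>
    using assms graph
    by (intro uniform_arrivals.intro uniform_arrivals_axioms.intro) auto
  have "(W \<union> nbhd 1 V E v) - {v} = (W \<union> {w \<in> V. (v, w) \<in> E}) - {v}" if "v \<in> W" for v
    using that assms(7) by (subst nbhd_1_eq) auto
  then have "(\<Sum>v\<in>W. \<P>(\<omega> in M. \<forall>w\<in>(W \<union> nbhd 1 V E v) - {v}.
      rsa_state (V - {v}) E (\<lambda>u. \<tau> u \<omega>) t w = 0)) = (\<Sum>v\<in>W. occupation_rate W v t)"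
    by (intro sum.cong refl) simp
  then show ?thesis
    using vacancy_derivative[OF assms(6-9)] by simp
qed

end
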